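(* The cubic polynomial $f(Y)=Y^3-2Y^2+Y-\frac{4}{91}\in\mathbb{R}[Y]$ has three distinct real roots; denote them by $\alpha<\beta<\gamma$. Set $$A=\frac{2(\gamma-\beta)}{(\beta-\alpha)(\gamma-\alpha)},\qquad B=\frac{2(\gamma-\alpha)}{(\beta-\alpha)(\gamma-\beta)},\qquad C=\frac{2(\beta-\alpha)}{(\gamma-\alpha)(\gamma-\beta)},$$ and define $a,b,c\in\mathbb{R}[X]$ by $$a=A(X^2-\alpha),\qquad b=B(X^2-\beta),\qquad c=C(X^2-\gamma).$$ Then $\{a,b,c\}$ is a four-square polynomial triple in $\mathbb{R}[X]$. More precisely, $$ab+1=\left(\frac{2X^2-\alpha-\beta}{\beta-\alpha}\right)^2,\qquad ac+1=\left(\frac{2X^2-\alpha-\gamma}{\gamma-\alpha}\right)^2,$$ $$bc+1=\left(\frac{2X^2-\beta-\gamma}{\gamma-\beta}\right)^2,\qquad abc+1=\left(\frac{\sqrt{91}}{2}\,X(X^2-1)\right)^2.$$ In particular, $a,b,c$ are pairwise different nonconstant polynomials. Their degrees (all equal to $2$) are minimal among all four-square polynomial triples over $\mathbb{R}[X]$ with nonconstant entries, i.e. if $\{a',b',c'\}\subset\mathbb{R}[X]$ is any four-square polynomial triple with $a',b',c'$ all nonconstant, then $\deg a',\deg b',\deg c'\ge 2$.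
   Context: A set $\{a,b,c\}\subset\mathbb{R}[X]$ of three (hence pairwise distinct) nonzero polynomials is called a four-square polynomial triple if there exist $r,s,t,u\in\mathbb{R}[X]$ such that $ab+1=r^2$, $ac+1=s^2$, $bc+1=t^2$, $abc+1=u^2$. *)

theory Defs
  imports Complex_Main "HOL-Computational_Algebra.Polynomial"
begin

abbreviation X :: "real poly" where "X \<equiv> [:0, 1:]"

definition four_square_polynomial_triple :: "real poly set \<Rightarrow> bool" where
  "four_square_polynomial_triple S \<longleftrightarrow>
     (\<exists>a b c. S = {a, b, c} \<and> a \<noteq> b \<and> a \<noteq> c \<and> b \<noteq> c \<and> a \<noteq> 0 \<and> b \<noteq> 0 \<and> c \<noteq> 0 \<and>
       (\<exists>r s t u. a * b + 1 = r ^ 2 \<and> a * c + 1 = s ^ 2 \<and> b * c + 1 = t ^ 2 \<and>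
                  a * b * c + 1 = u ^ 2))"

definition cubic_f :: "real poly" where
  "cubic_f = X ^ 3 - 2 * X ^ 2 + X - [:4 / 91:]"

end

theory Submission
  imports Defs
begin

text \<open>
  With \<open>D = (\<beta> - \<alpha>)(\<gamma> - \<alpha>)(\<gamma> - \<beta>)\<close> one has \<open>AB = 4 / (\<beta> - \<alpha>)\<^sup>2\<close> and
  similarly for the other pairs, so the first three identities are instances of
  \<open>4(x - \<alpha>)(x - \<beta>) + (\<beta> - \<alpha>)\<^sup>2 = (2x - \<alpha> - \<beta>)\<^sup>2\<close>. Moreover \<open>ABC = 8 / D\<close>, and \<open>D\<^sup>2\<close>
  is the discriminant of the cubic, \<open>(32 / 91)\<^sup>2\<close>; hence
  \<open>abc + 1 = (91 / 4) f(X\<^sup>2) + 1\<close>, and \<open>f\<close> was chosen as \<open>Y(Y - 1)\<^sup>2 - 4 / 91\<close>.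
  For minimality, squares have even degree: the pairwise sums of the three degrees and their
  total are even, hence each of the degrees is even.
\<close>

lemma poly_cubic_f: "poly cubic_f y = y ^ 3 - 2 * y ^ 2 + y - 4 / 91"
  by (simp add: cubic_f_def)

text \<open>The values at 0, 1/3, 1, 2 alternate in sign, starting negative, so the intermediate
  value theorem gives a root in each of three disjoint intervals. The points 1/3 and 1 are the
  critical points of \<open>y * (y - 1) ^ 2\<close>. The degree bounds the number of roots from
  above.\<close>

lemma card_roots_cubic_f: "card {y. poly cubic_f y = 0} = 3"
proof -
  have coeff3: "coeff cubic_f 3 = 1"
    by (simp add: cubic_f_def numeral_eq_Suc numeral_poly)
  have deg: "degree cubic_f \<le> 3"
    by (rule degree_le) (auto simp: cubic_f_def numeral_eq_Suc numeral_poly coeff_pCons split: nat.splits)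
  have nz: "cubic_f \<noteq> 0" using coeff3 by auto
  obtain x where x: "0 < x" "x < 1 / 3" "poly cubic_f x = 0"
    using poly_IVT_pos[of 0 "1 / 3" cubic_f] by (auto simp: poly_cubic_f power2_eq_square power3_eq_cube)
  obtain y where y: "1 / 3 < y" "y < 1" "poly cubic_f y = 0"
    using poly_IVT_neg[of "1 / 3" 1 cubic_f] by (auto simp: poly_cubic_f power2_eq_square power3_eq_cube)
  obtain z where z: "1 < z" "z < 2" "poly cubic_f z = 0"
    using poly_IVT_pos[of 1 2 cubic_f] by (auto simp: poly_cubic_f)
  have "3 = card {x, y, z}" using x y z by auto
  also have "\<dots> \<le> card {y. poly cubic_f y = 0}"
    using x y z poly_roots_finite[OF nz] by (intro card_mono) auto
  finally have "3 \<le> card {y. poly cubic_f y = 0}" .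
  moreover have "card {y. poly cubic_f y = 0} \<le> 3"
    using card_poly_roots_bound[OF nz] deg by simp
  ultimately show ?thesis by simp
qed

lemma cubic_f_vieta:
  assumes "\<alpha> \<noteq> \<beta>" "\<alpha> \<noteq> \<gamma>" "\<beta> \<noteq> \<gamma>"
    and "poly cubic_f \<alpha> = 0" "poly cubic_f \<beta> = 0" "poly cubic_f \<gamma> = 0"
  shows "\<alpha> + \<beta> + \<gamma> = 2" and "\<alpha> * \<beta> + \<alpha> * \<gamma> + \<beta> * \<gamma> = 1" and "\<alpha> * \<beta> * \<gamma> = 4 / 91"
proof -
  \<comment> \<open>\<open>q u v\<close> is the divided difference (f(u) - f(v)) / (u - v) of the
    cubic, extended to u = v; it vanishes at two distinct roots. Taking the divided difference of
    \<open>q \<alpha>\<close> at \<beta> and \<gamma> then yields the sum of the roots.\<close>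
  define q where "q u v = u ^ 2 + u * v + v ^ 2 - 2 * (u + v) + 1" for u v :: real
  have q: "q u v = 0" if "u \<noteq> v" "poly cubic_f u = 0" "poly cubic_f v = 0" for u v
  proof -
    have "(u - v) * q u v = poly cubic_f u - poly cubic_f v"
      unfolding q_def poly_cubic_f by algebra
    with that show ?thesis by simp
  qed
  have qab: "q \<alpha> \<beta> = 0" and qac: "q \<alpha> \<gamma> = 0" using q assms by auto
  have "(\<beta> - \<gamma>) * (\<alpha> + \<beta> + \<gamma> - 2) = q \<alpha> \<beta> - q \<alpha> \<gamma>"
    unfolding q_def by algebra
  then show e1: "\<alpha> + \<beta> + \<gamma> = 2" using qab qac assms(3) by simp
  then have g: "\<gamma> = 2 - \<alpha> - \<beta>" by simp
  show e2: "\<alpha> * \<beta> + \<alpha> * \<gamma> + \<beta> * \<gamma> = 1"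
    using qab unfolding q_def g by algebra
  have "\<alpha> * \<beta> * \<gamma> = \<alpha> ^ 3 - 2 * \<alpha> ^ 2 + \<alpha>"
  proof -
    \<comment> \<open>This is the expansion of (Y - \<alpha>)(Y - \<beta>)(Y - \<gamma>), evaluated
      at its zero Y = \<alpha>.\<close>
    have "\<alpha> * \<beta> * \<gamma> = \<alpha> * (\<alpha> * \<beta> + \<alpha> * \<gamma> + \<beta> * \<gamma>) - \<alpha> ^ 2 * (\<alpha> + \<beta> + \<gamma>) + \<alpha> ^ 3"
      by algebra
    then show ?thesis unfolding e1 e2 by simp
  qed
  then show "\<alpha> * \<beta> * \<gamma> = 4 / 91" using assms(4) by (simp add: poly_cubic_f)
qed

lemma cubic_f_root_differences:
  assumes lt: "\<alpha> < \<beta>" "\<beta> < \<gamma>"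
    and "poly cubic_f \<alpha> = 0" "poly cubic_f \<beta> = 0" "poly cubic_f \<gamma> = 0"
  shows "(\<beta> - \<alpha>) * (\<gamma> - \<alpha>) * (\<gamma> - \<beta>) = 32 / 91"
proof -
  have distinct: "\<alpha> \<noteq> \<beta>" "\<alpha> \<noteq> \<gamma>" "\<beta> \<noteq> \<gamma>" using lt by auto
  note vieta = cubic_f_vieta[OF distinct assms(3-5)]
  define s p k where "s = \<alpha> + \<beta> + \<gamma>" and "p = \<alpha> * \<beta> + \<alpha> * \<gamma> + \<beta> * \<gamma>"
    and "k = \<alpha> * \<beta> * \<gamma>"
  \<comment> \<open>The right-hand side is the discriminant of Y^3 - s Y^2 + p Y - k. For s = 2 and
    p = 1 it reduces to k (4 - 27 k), which is a rational square at k = 4/91. The ordering of the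
    roots fixes the sign when the square root is taken.\<close>
  have "((\<beta> - \<alpha>) * (\<gamma> - \<alpha>) * (\<gamma> - \<beta>)) ^ 2
      = s ^ 2 * p ^ 2 - 4 * p ^ 3 - 4 * s ^ 3 * k + 18 * s * p * k - 27 * k ^ 2"
    unfolding s_def p_def k_def by algebra
  also have "\<dots> = (32 / 91) ^ 2"
    unfolding s_def p_def k_def vieta by (simp add: power2_eq_square)
  finally show ?thesis
    by (rule power2_eq_imp_eq) (use lt in auto)
qed

text \<open>Only the product \<open>A * B\<close> and the two roots enter, so one statement serves
  all three pairs. The polynomial identity is checked pointwise.\<close>

lemma smult_square_identity:
  fixes \<alpha> \<beta> A B :: real
  assumes "\<alpha> \<noteq> \<beta>" and "A * B = 4 / (\<beta> - \<alpha>) ^ 2"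
  shows "smult A (X ^ 2 - [:\<alpha>:]) * smult B (X ^ 2 - [:\<beta>:]) + 1
    = (smult (1 / (\<beta> - \<alpha>)) (2 * X ^ 2 - [:\<alpha>:] - [:\<beta>:])) ^ 2"
proof (rule poly_ext)
  fix x
  have "(A * (x ^ 2 - \<alpha>)) * (B * (x ^ 2 - \<beta>)) + 1
      = (A * B) * ((x ^ 2 - \<alpha>) * (x ^ 2 - \<beta>)) + 1"
    by (simp add: algebra_simps)
  also have "\<dots> = (4 * ((x ^ 2 - \<alpha>) * (x ^ 2 - \<beta>)) + (\<beta> - \<alpha>) ^ 2) / (\<beta> - \<alpha>) ^ 2"
    using assms by (simp add: add_divide_distrib)
  also have "4 * ((x ^ 2 - \<alpha>) * (x ^ 2 - \<beta>)) + (\<beta> - \<alpha>) ^ 2 = (2 * x ^ 2 - \<alpha> - \<beta>) ^ 2"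
    by algebra
  finally show "poly (smult A (X ^ 2 - [:\<alpha>:]) * smult B (X ^ 2 - [:\<beta>:]) + 1) x
      = poly ((smult (1 / (\<beta> - \<alpha>)) (2 * X ^ 2 - [:\<alpha>:] - [:\<beta>:])) ^ 2) x"
    by (simp add: power_divide mult_ac)
qed

lemma smult_triple_square_identity:
  fixes \<alpha> \<beta> \<gamma> A B C :: real
  assumes "A * B * C = 91 / 4"
    and vieta: "\<alpha> + \<beta> + \<gamma> = 2" "\<alpha> * \<beta> + \<alpha> * \<gamma> + \<beta> * \<gamma> = 1" "\<alpha> * \<beta> * \<gamma> = 4 / 91"
  shows "smult A (X ^ 2 - [:\<alpha>:]) * smult B (X ^ 2 - [:\<beta>:]) * smult C (X ^ 2 - [:\<gamma>:]) + 1
    = (smult (sqrt 91 / 2) (X * (X ^ 2 - 1))) ^ 2"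
proof (rule poly_ext)
  fix x
  have "(x ^ 2 - \<alpha>) * (x ^ 2 - \<beta>) * (x ^ 2 - \<gamma>)
      = (x ^ 2) ^ 3 - (\<alpha> + \<beta> + \<gamma>) * (x ^ 2) ^ 2
        + (\<alpha> * \<beta> + \<alpha> * \<gamma> + \<beta> * \<gamma>) * x ^ 2 - \<alpha> * \<beta> * \<gamma>"
    by algebra
  also have "\<dots> = (x * (x ^ 2 - 1)) ^ 2 - 4 / 91"
    unfolding vieta by algebra
  \<comment> \<open>The factor 91/4 turns the constant term -4/91 into -1, which cancels the added
    1.\<close>
  finally have "(A * B * C) * ((x ^ 2 - \<alpha>) * (x ^ 2 - \<beta>) * (x ^ 2 - \<gamma>)) + 1
      = 91 / 4 * (x * (x ^ 2 - 1)) ^ 2"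
    unfolding assms(1) by (simp only: right_diff_distrib)
  then show "poly (smult A (X ^ 2 - [:\<alpha>:]) * smult B (X ^ 2 - [:\<beta>:])
        * smult C (X ^ 2 - [:\<gamma>:]) + 1) x
      = poly ((smult (sqrt 91 / 2) (X * (X ^ 2 - 1))) ^ 2) x"
    by (simp add: power_mult_distrib power_divide mult_ac)
qed

lemma degree_smult_X2_minus_const:
  assumes "A \<noteq> 0"
  shows "degree (smult A (X ^ 2 - [:\<alpha>:])) = 2"
  using assms by (simp add: power2_eq_square)

lemma smult_X2_minus_const_eq_iff:
  assumes "A \<noteq> 0"
  shows "smult A (X ^ 2 - [:\<alpha>:]) = smult B (X ^ 2 - [:\<beta>:]) \<longleftrightarrow> A = B \<and> \<alpha> = \<beta>"
  using assms by (auto simp: power2_eq_square)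

text \<open>Adding 1 does not change a positive degree, and over an integral domain squaring doubles
  degrees. The constant case, which includes \<open>p = -1\<close> with \<open>r = 0\<close>, is
  trivial.\<close>

lemma even_degree_if_plus_one_square:
  fixes p r :: "'a::idom poly"
  assumes "p + 1 = r ^ 2"
  shows "even (degree p)"
proof (cases "degree p = 0")
  case False
  then have "degree p = degree (p + 1)" by (simp add: degree_add_eq_left)
  also have "\<dots> = 2 * degree r" using assms by (metis degree_power_eq degree_0 mult_0_right power_zero_numeral)
  finally show ?thesis by simp
qed simp

lemma four_square_polynomial_triple_even_degree:
  assumes "four_square_polynomial_triple S" and "p \<in> S"
  shows "even (degree p)"
proof -
  obtain a b c r s t u where abc: "S = {a, b, c}" "a \<noteq> 0" "b \<noteq> 0" "c \<noteq> 0"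
    and sq: "a * b + 1 = r ^ 2" "a * c + 1 = s ^ 2" "b * c + 1 = t ^ 2" "a * b * c + 1 = u ^ 2"
    using assms(1) unfolding four_square_polynomial_triple_def by blast
  \<comment> \<open>Degrees add under multiplication because the entries are nonzero. Subtracting a
    pairwise sum from the total leaves the degree of the third entry.\<close>
  have "even (degree a + degree b)" "even (degree a + degree c)" "even (degree b + degree c)"
    "even (degree a + degree b + degree c)"
    using sq[THEN even_degree_if_plus_one_square] abc by (simp_all add: degree_mult_eq)
  then show ?thesis using assms(2) abc(1) by auto
qed

lemma four_square_polynomial_triple_degree_ge_2:
  assumes "four_square_polynomial_triple S" and "p \<in> S" and "degree p > 0"
  shows "degree p \<ge> 2"
  using four_square_polynomial_triple_even_degree[OF assms(1,2)] assms(3) by presburger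

theorem theorem3p2:
  "card {y. poly cubic_f y = 0} = 3 \<and>
   (\<forall>\<alpha> \<beta> \<gamma> :: real.
      \<alpha> < \<beta> \<and> \<beta> < \<gamma> \<and> {y. poly cubic_f y = 0} = {\<alpha>, \<beta>, \<gamma>} \<longrightarrow>
      (let A = 2 * (\<gamma> - \<beta>) / ((\<beta> - \<alpha>) * (\<gamma> - \<alpha>));
           B = 2 * (\<gamma> - \<alpha>) / ((\<beta> - \<alpha>) * (\<gamma> - \<beta>));
           C = 2 * (\<beta> - \<alpha>) / ((\<gamma> - \<alpha>) * (\<gamma> - \<beta>));
           a = smult A (X ^ 2 - [:\<alpha>:]);
           b = smult B (X ^ 2 - [:\<beta>:]);
           c = smult C (X ^ 2 - [:\<gamma>:])
       in four_square_polynomial_triple {a, b, c} \<and>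
          a * b + 1 = (smult (1 / (\<beta> - \<alpha>)) (2 * X ^ 2 - [:\<alpha>:] - [:\<beta>:])) ^ 2 \<and>
          a * c + 1 = (smult (1 / (\<gamma> - \<alpha>)) (2 * X ^ 2 - [:\<alpha>:] - [:\<gamma>:])) ^ 2 \<and>
          b * c + 1 = (smult (1 / (\<gamma> - \<beta>)) (2 * X ^ 2 - [:\<beta>:] - [:\<gamma>:])) ^ 2 \<and>
          a * b * c + 1 = (smult (sqrt 91 / 2) (X * (X ^ 2 - 1))) ^ 2 \<and>
          a \<noteq> b \<and> a \<noteq> c \<and> b \<noteq> c \<and>
          degree a = 2 \<and> degree b = 2 \<and> degree c = 2)) \<and>
   (\<forall>a' b' c' :: real poly.
      four_square_polynomial_triple {a', b', c'} \<and>
      degree a' > 0 \<and> degree b' > 0 \<and> degree c' > 0 \<longrightarrow>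
      degree a' \<ge> 2 \<and> degree b' \<ge> 2 \<and> degree c' \<ge> 2)"
proof (intro conjI allI impI, goal_cases)
  case 1
  show ?case by (rule card_roots_cubic_f)
next
  case (2 \<alpha> \<beta> \<gamma>)
  then have lt: "\<alpha> < \<beta>" "\<beta> < \<gamma>"
    and roots: "poly cubic_f \<alpha> = 0" "poly cubic_f \<beta> = 0" "poly cubic_f \<gamma> = 0"
    by auto
  have distinct: "\<alpha> \<noteq> \<beta>" "\<alpha> \<noteq> \<gamma>" "\<beta> \<noteq> \<gamma>" using lt by auto
  note vieta = cubic_f_vieta[OF distinct roots]
  define A B C where "A = 2 * (\<gamma> - \<beta>) / ((\<beta> - \<alpha>) * (\<gamma> - \<alpha>))"
    and "B = 2 * (\<gamma> - \<alpha>) / ((\<beta> - \<alpha>) * (\<gamma> - \<beta>))"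
    and "C = 2 * (\<beta> - \<alpha>) / ((\<gamma> - \<alpha>) * (\<gamma> - \<beta>))"
  note ABC_defs = A_def B_def C_def
  have nz: "A \<noteq> 0" "B \<noteq> 0" "C \<noteq> 0" using distinct by (simp_all add: ABC_defs)
  have AB: "A * B = 4 / (\<beta> - \<alpha>) ^ 2" and AC: "A * C = 4 / (\<gamma> - \<alpha>) ^ 2"
    and BC: "B * C = 4 / (\<gamma> - \<beta>) ^ 2"
    using distinct by (simp_all add: ABC_defs power2_eq_square divide_simps) (simp_all add: algebra_simps)
  \<comment> \<open>The numerator of \<open>C\<close> cancels one of the two factors \<beta> -
    \<alpha> in the denominator of \<open>A * B\<close>.\<close>
  have "A * B * C = 8 / ((\<beta> - \<alpha>) * (\<gamma> - \<alpha>) * (\<gamma> - \<beta>))"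
    unfolding AB using distinct by (simp add: C_def power2_eq_square divide_simps)
  then have ABC: "A * B * C = 91 / 4"
    unfolding cubic_f_root_differences[OF lt roots] by simp
  define a b c where "a = smult A (X ^ 2 - [:\<alpha>:])" and "b = smult B (X ^ 2 - [:\<beta>:])"
    and "c = smult C (X ^ 2 - [:\<gamma>:])"
  note abc_defs = a_def b_def c_def
  have identities:
    "a * b + 1 = (smult (1 / (\<beta> - \<alpha>)) (2 * X ^ 2 - [:\<alpha>:] - [:\<beta>:])) ^ 2"
    "a * c + 1 = (smult (1 / (\<gamma> - \<alpha>)) (2 * X ^ 2 - [:\<alpha>:] - [:\<gamma>:])) ^ 2"
    "b * c + 1 = (smult (1 / (\<gamma> - \<beta>)) (2 * X ^ 2 - [:\<beta>:] - [:\<gamma>:])) ^ 2"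
    "a * b * c + 1 = (smult (sqrt 91 / 2) (X * (X ^ 2 - 1))) ^ 2"
    unfolding abc_defs
    by (fact smult_square_identity[OF distinct(1) AB] smult_square_identity[OF distinct(2) AC]
        smult_square_identity[OF distinct(3) BC] smult_triple_square_identity[OF ABC vieta])+
  have deg: "degree a = 2" "degree b = 2" "degree c = 2"
    unfolding abc_defs using nz by (simp_all only: degree_smult_X2_minus_const not_False_eq_True)
  then have nonzero: "a \<noteq> 0" "b \<noteq> 0" "c \<noteq> 0" by auto
  \<comment> \<open>The polynomials have different zeros in X^2, so the distinctness of the roots
    suffices and \<open>A\<close>, \<open>B\<close>, \<open>C\<close> need not be compared.\<close>
  have neq: "a \<noteq> b" "a \<noteq> c" "b \<noteq> c"
    unfolding abc_defs using nz distinct smult_X2_minus_const_eq_iff by blast+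
  have "four_square_polynomial_triple {a, b, c}"
    unfolding four_square_polynomial_triple_def using identities nonzero neq by blast
  with identities deg neq show ?case
    unfolding Let_def A_def[symmetric] B_def[symmetric] C_def[symmetric]
      a_def[symmetric] b_def[symmetric] c_def[symmetric]
    by blast
\<comment> \<open>What remains are the three degree bounds of the minimality claim.\<close>
qed (use four_square_polynomial_triple_degree_ge_2 in blast)+

end
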